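(* Let $\mathcal{V}\subset\mathbb{A}^7$ be the affine variety over $\mathbb{Q}$ with coordinates $(x,y,z,P,Q,R,S)$ defined by \[ x^2+y^2+z^2=P^2,\quad (1-x)^2+y^2+z^2=Q^2,\quad x^2+(1-y)^2+z^2=R^2,\quad (1-x)^2+(1-y)^2+z^2=S^2. \] (Its rational points correspond to points $(x,y,z)\in\mathbb{Q}^3$ at rational distance from each of $(0,0,0),(1,0,0),(0,1,0),(1,1,0)$.) Then $\mathcal{V}$ is unirational over $\mathbb{Q}$, i.e. there is a dominant rational map defined over $\mathbb{Q}$ from an affine space onto $\mathcal{V}$.
   Context: No further context is needed. *)

theory Defs
  imports Complex_Main
begin

datatype pexpr = Var nat | Const rat | Add pexpr pexpr | Mul pexpr pexpr | Neg pexpr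

fun peval :: "pexpr \<Rightarrow> (nat \<Rightarrow> 'a::field_char_0) \<Rightarrow> 'a" where
  "peval (Var i) v = v i"
| "peval (Const c) v = of_rat c"
| "peval (Add p q) v = peval p v + peval q v"
| "peval (Mul p q) v = peval p v * peval q v"
| "peval (Neg p) v = - peval p v"

text \<open>The variety V in A^7 with coordinates 0..6 = (x,y,z,P,Q,R,S).\<close>
definition in_V :: "(nat \<Rightarrow> 'a::field_char_0) \<Rightarrow> bool" where
  "in_V w \<longleftrightarrow>
     (w 0)^2 + (w 1)^2 + (w 2)^2 = (w 3)^2 \<and>
     (1 - w 0)^2 + (w 1)^2 + (w 2)^2 = (w 4)^2 \<and>
     (w 0)^2 + (1 - w 1)^2 + (w 2)^2 = (w 5)^2 \<and>
     (1 - w 0)^2 + (1 - w 1)^2 + (w 2)^2 = (w 6)^2"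

text \<open>A rational map from affine space (coordinates t 0, t 1, ...; only finitely many
  occur) to A^7, given by numerators and denominators of its 7 components.
  It is defined at t when all denominators are nonzero; the value is padded by 0
  beyond coordinate 6.\<close>
definition rdefined :: "(nat \<Rightarrow> pexpr) \<Rightarrow> (nat \<Rightarrow> rat) \<Rightarrow> bool" where
  "rdefined den t \<longleftrightarrow> (\<forall>i<7. peval (den i) t \<noteq> 0)"

definition rmap :: "(nat \<Rightarrow> pexpr) \<Rightarrow> (nat \<Rightarrow> pexpr) \<Rightarrow> (nat \<Rightarrow> rat) \<Rightarrow> nat \<Rightarrow> rat" where
  "rmap num den t = (\<lambda>i. if i < 7 then peval (num i) t / peval (den i) t else 0)"

text \<open>A dominant rational map over Q from an affine space to V:
  the denominators are nonzero polynomials; the map lands in V;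
  and every Q-polynomial vanishing on the image vanishes on all of V
  (V taken with its complex points, i.e. the image is Zariski dense in V).\<close>
definition dominant_rational_map_to_V :: "(nat \<Rightarrow> pexpr) \<Rightarrow> (nat \<Rightarrow> pexpr) \<Rightarrow> bool" where
  "dominant_rational_map_to_V num den \<longleftrightarrow>
     (\<forall>i<7. \<exists>t::nat \<Rightarrow> rat. peval (den i) t \<noteq> 0) \<and>
     (\<forall>t. rdefined den t \<longrightarrow> in_V (rmap num den t)) \<and>
     (\<forall>g. (\<forall>t. rdefined den t \<longrightarrow> peval g (rmap num den t) = 0) \<longrightarrow>
          (\<forall>w::nat \<Rightarrow> complex. (\<forall>i\<ge>7. w i = 0) \<longrightarrow> in_V w \<longrightarrow> peval g w = 0))"

definition V_unirational :: bool where
  "V_unirational \<longleftrightarrow> (\<exists>fnum fden. dominant_rational_map_to_V fnum fden)"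

end

theory Submission
  imports Defs "HOL-Computational_Algebra.Polynomial"
begin

text \<open>
  The variety is birational to the double cover \<open>y\<^sup>2 = F(t, u, v)\<close> of affine 3-space, where \<open>F\<close> is a
  quartic in \<open>(u, v)\<close>. The surface \<open>u = 0\<close> (the plane \<open>x = 1/2\<close>) is unirational: it is a conic bundle
  which acquires a section after a quadratic base change. Through each of its points \<open>(t, 0, v, y)\<close>
  and each direction \<open>(1, d)\<close> the osculating parabola of the curve \<open>y\<^sup>2 = F\<close> over that line meets the
  curve in one further rational point. These points depend on three parameters, and for
  \<open>d \<rightarrow> 0\<close> they trace an arc transversal to \<open>u = 0\<close>. Hence a polynomial in \<open>(t, u, v)\<close> vanishing on
  the image vanishes on \<open>u = 0\<close>, may be divided by \<open>u\<close>, and is therefore zero. The image is stable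
  under \<open>z \<mapsto> -z\<close>, so for a regular function \<open>a + b z\<close> vanishing on it both \<open>a\<close> and \<open>b z\<^sup>2\<close>
  vanish on the image, hence everywhere.
\<close>

section \<open>A double cover of affine space\<close>

definition ccoef :: "'a::field_char_0 \<Rightarrow> 'a" where "ccoef t = (t^2 + 1) / 2"
definition kcoef :: "'a::field_char_0 \<Rightarrow> 'a" where "kcoef t = (t^2 - 1) / 4"
definition ecoef :: "'a::field_char_0 \<Rightarrow> 'a" where "ecoef t = 2 * (kcoef t)^2 - t^2"

definition quartic :: "'a::field_char_0 \<Rightarrow> 'a \<Rightarrow> 'a \<Rightarrow> 'a" where
  "quartic t u v = ccoef t * (u^2 + v^2) + ecoef t * u^2 * v^2 - (kcoef t)^2 * (u^4 + v^4) - 2"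

text \<open>Put \<open>u = P - Q\<close>, \<open>v = R + S\<close>, \<open>t v = P + Q\<close>, \<open>t u = R - S\<close>; this solves
  \<open>P\<^sup>2 - Q\<^sup>2 = R\<^sup>2 - S\<^sup>2\<close>. The remaining equation becomes \<open>y\<^sup>2 = quartic t u v\<close>, where \<open>y\<close> is
  twice the coordinate \<open>z\<close>.\<close>

definition chart :: "'a::field_char_0 \<Rightarrow> 'a \<Rightarrow> 'a \<Rightarrow> 'a \<Rightarrow> nat \<Rightarrow> 'a" where
  "chart t u v y =
     (\<lambda>_. 0)(0 := (1 + t * u * v) / 2, 1 := (1 + kcoef t * (v^2 - u^2)) / 2, 2 := y / 2,
       3 := (t * v + u) / 2, 4 := (t * v - u) / 2, 5 := (v + t * u) / 2, 6 := (v - t * u) / 2)"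

lemma chart_in_V:
  assumes "y^2 = quartic t u v"
  shows "in_V (chart t u v y)"
  using assms unfolding in_V_def chart_def quartic_def ccoef_def ecoef_def kcoef_def
  by (simp add: field_simps) algebra

text \<open>\<open>slice t v = quartic t 0 v\<close>, and \<open>slice'\<close> is its derivative in \<open>v\<close>. From \<open>(0, v, y)\<close> move in the
  direction \<open>(1, d)\<close>: the curve \<open>y\<^sup>2 = quartic t l (v + d l)\<close> in \<open>(l, y)\<close> and the parabola that osculates it
  to third order at \<open>l = 0\<close> have one further common point, at \<open>l = step t v d\<close>. Its \<open>y\<close>-coordinate is
  \<open>yratio t v d\<close> times the original one.\<close>

definition slice :: "'a::field_char_0 \<Rightarrow> 'a \<Rightarrow> 'a" where
  "slice t v = ccoef t * v^2 - (kcoef t)^2 * v^4 - 2"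
definition slice' :: "'a::field_char_0 \<Rightarrow> 'a \<Rightarrow> 'a" where
  "slice' t v = 2 * ccoef t * v - 4 * (kcoef t)^2 * v^3"
definition quad :: "'a::field_char_0 \<Rightarrow> 'a \<Rightarrow> 'a \<Rightarrow> 'a" where
  "quad t v d = 4 * slice t v * (d^2 * (ccoef t - 6 * (kcoef t)^2 * v^2) + ccoef t + ecoef t * v^2)
     - d^2 * (slice' t v)^2"
definition step_num :: "'a::field_char_0 \<Rightarrow> 'a \<Rightarrow> 'a \<Rightarrow> 'a" where
  "step_num t v d = 8 * slice t v * (slice' t v * quad t v d
     - 8 * (slice t v)^2 * (2 * ecoef t * v - 4 * (kcoef t)^2 * v * d^2))"
definition step_den :: "'a::field_char_0 \<Rightarrow> 'a \<Rightarrow> 'a \<Rightarrow> 'a" where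
  "step_den t v d = 64 * (slice t v)^3 * (ecoef t * d^2 - (kcoef t)^2 - (kcoef t)^2 * d^4)
     - (quad t v d)^2"
definition step :: "'a::field_char_0 \<Rightarrow> 'a \<Rightarrow> 'a \<Rightarrow> 'a" where
  "step t v d = d * step_num t v d / step_den t v d"
definition yratio :: "'a::field_char_0 \<Rightarrow> 'a \<Rightarrow> 'a \<Rightarrow> 'a" where
  "yratio t v d = 1 + d * slice' t v * step t v d / (2 * slice t v)
     + quad t v d * (step t v d)^2 / (8 * (slice t v)^2)"

lemma quartic_line:
  "quartic t l (v + d * l) = slice t v + d * slice' t v * l
     + (d^2 * (ccoef t - 6 * (kcoef t)^2 * v^2) + ccoef t + ecoef t * v^2) * l^2
     + d * (2 * ecoef t * v - 4 * (kcoef t)^2 * v * d^2) * l^3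
     + (ecoef t * d^2 - (kcoef t)^2 - (kcoef t)^2 * d^4) * l^4"
  unfolding quartic_def slice_def slice'_def by algebra

text \<open>The squared factor is the Taylor polynomial of degree 2 in \<open>l\<close> of the
  square root of the left-hand side divided by \<open>f\<close>. Hence both sides agree through
  \<open>l^2\<close>, and \<open>64 * f^3\<close> times their difference is \<open>l^3\<close> times
  a linear polynomial; the hypothesis on \<open>l\<close> says that this linear polynomial vanishes.
  No square root of \<open>f\<close> is taken, so a given root of \<open>f\<close> can be multiplied
  in later.\<close>

lemma parabola:
  fixes f :: "'a::field_char_0"
  assumes "f \<noteq> 0" and "b = 4 * f * a2 - a1^2"
    and l: "l * (64 * f^3 * a4 - b^2) = 8 * f * (a1 * b - 8 * f^2 * a3)"
  shows "f + a1 * l + a2 * l^2 + a3 * l^3 + a4 * l^4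
    = f * (1 + a1 * l / (2 * f) + b * l^2 / (8 * f^2))^2"
proof -
  have "64 * f^3 * (f + a1 * l + a2 * l^2 + a3 * l^3 + a4 * l^4) = (8*f^2 + 4*f*a1 * l + b * l^2)^2"
    using assms(2) l by algebra
  also have "\<dots> = 64 * f^3 * (f * (1 + a1 * l / (2 * f) + b * l^2 / (8 * f^2))^2)"
    using \<open>f \<noteq> 0\<close> by (simp add: field_simps power2_eq_square power3_eq_cube) 
  finally show ?thesis using \<open>f \<noteq> 0\<close> by simp
qed

lemma quartic_step:
  assumes "slice t v \<noteq> 0" "step_den t v d \<noteq> 0" "y^2 = slice t v"
  shows "(y * yratio t v d)^2 = quartic t (step t v d) (v + d * step t v d)"
proof -
  have "step t v d * (64 * (slice t v)^3 * (ecoef t * d^2 - (kcoef t)^2 - (kcoef t)^2 * d^4)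
     - (quad t v d)^2) = 8 * slice t v * (d * slice' t v * quad t v d
     - 8 * (slice t v)^2 * (d * (2 * ecoef t * v - 4 * (kcoef t)^2 * v * d^2)))"
    using assms(2) by (simp add: step_def step_num_def step_den_def field_simps)
  from parabola[OF assms(1) _ this, of "d^2 * (ccoef t - 6 * (kcoef t)^2 * v^2) + ccoef t + ecoef t * v^2"]
  show ?thesis
    by (simp add: quartic_line yratio_def power_mult_distrib assms(3) quad_def)
qed

text \<open>On \<open>u = 0\<close> one has \<open>t * v = 2 P\<close> and \<open>v = 2 R\<close>,
  so \<open>w = P + R\<close> and \<open>m = P - R\<close>. The symmetric functions of
  \<open>w\<close> and \<open>m\<close> absorb the coefficients, and for fixed \<open>m\<close> the
  quartic in \<open>v\<close> becomes quadratic in \<open>w\<close>: this is the conic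
  bundle.\<close>

lemma slice_eq:
  assumes "t * v = w + m" "v = w - m"
  shows "slice t v = w^2 + m^2 - (w * m)^2 - 2"
proof -
  have 1: "ccoef t * v^2 = w^2 + m^2"
  proof -
    have "ccoef t * v^2 = ((t * v)^2 + v^2) / 2" by (simp add: ccoef_def field_simps)
    also have "\<dots> = ((w + m)^2 + (w - m)^2) / 2" by (metis assms)
    also have "\<dots> = w^2 + m^2" by (simp add: field_simps power2_eq_square)
    finally show ?thesis .
  qed
  have 2: "kcoef t * v^2 = w * m"
  proof -
    have "kcoef t * v^2 = ((t * v)^2 - v^2) / 4" by (simp add: kcoef_def field_simps)
    also have "\<dots> = ((w + m)^2 - (w - m)^2) / 4" by (metis assms)
    also have "\<dots> = w * m" by (simp add: field_simps power2_eq_square)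
    finally show ?thesis .
  qed
  have 3: "x^2 * a^4 = (x * a^2)^2" for x a :: 'a by algebra
  show ?thesis unfolding slice_def 3 1 2 by simp
qed

section \<open>Polynomials and rational functions\<close>

text \<open>A property of functions, so that closure rules carry it through \<open>peval\<close> and
  it can be applied to one variable at a time.\<close>

definition polyfun :: "('a::comm_ring_1 \<Rightarrow> 'a) \<Rightarrow> bool" where
  "polyfun f \<longleftrightarrow> (\<exists>p. \<forall>x. f x = poly p x)"

lemma polyfun_const [intro]: "polyfun (\<lambda>_. c)"
  unfolding polyfun_def by (rule exI[of _ "[:c:]"]) simp

lemma polyfun_id [intro]: "polyfun (\<lambda>x. x)"
  unfolding polyfun_def by (rule exI[of _ "[:0, 1:]"]) simp

lemma polyfun_add [intro]: "polyfun f \<Longrightarrow> polyfun g \<Longrightarrow> polyfun (\<lambda>x. f x + g x)"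
  unfolding polyfun_def by (metis poly_add)

lemma polyfun_mult [intro]: "polyfun f \<Longrightarrow> polyfun g \<Longrightarrow> polyfun (\<lambda>x. f x * g x)"
  unfolding polyfun_def by (metis poly_mult)

lemma polyfun_minus [intro]: "polyfun f \<Longrightarrow> polyfun (\<lambda>x. - f x)"
  unfolding polyfun_def by (metis poly_minus)

lemma polyfun_If [intro]: "polyfun f \<Longrightarrow> polyfun g \<Longrightarrow> polyfun (\<lambda>x. if b then f x else g x)"
  by (cases b) simp_all

lemma polyfun_peval:
  assumes "\<And>i. polyfun (\<lambda>x. w x i)"
  shows "polyfun (\<lambda>x. peval h (w x))"
  by (induction h) (auto intro: assms)

lemma polyfun_eq_0:
  fixes f :: "'a::idom \<Rightarrow> 'a"
  assumes "polyfun f" "infinite A" "\<And>x. x \<in> A \<Longrightarrow> f x = 0"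
  shows "f x = 0"
proof -
  obtain p where p: "\<And>x. f x = poly p x" using assms(1) unfolding polyfun_def by blast
  have "A \<subseteq> {x. poly p x = 0}" using assms(3) p by auto
  then have "p = 0" using assms(2) poly_roots_finite finite_subset by blast
  then show ?thesis by (simp add: p)
qed

text \<open>The outer variable is \<open>x\<close> and the coefficients are polynomials in
  \<open>y\<close>, so that \<open>pCons a q\<close> is the splitting a(y) + x q(x, y) and induction
  on \<open>p\<close> divides by \<open>x\<close>.\<close>

definition bipolyfun :: "('a::comm_ring_1 \<Rightarrow> 'a \<Rightarrow> 'a) \<Rightarrow> bool" where
  "bipolyfun f \<longleftrightarrow> (\<exists>p. \<forall>x y. f x y = poly (poly p [:x:]) y)"

lemma bipolyfun_const [intro]: "bipolyfun (\<lambda>_ _. c)"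
  unfolding bipolyfun_def by (rule exI[of _ "[:[:c:]:]"]) simp

lemma bipolyfun_fst [intro]: "bipolyfun (\<lambda>x y. x)"
  unfolding bipolyfun_def by (rule exI[of _ "[:0, 1:]"]) simp

lemma bipolyfun_snd [intro]: "bipolyfun (\<lambda>x y. y)"
  unfolding bipolyfun_def by (rule exI[of _ "[:[:0, 1:]:]"]) simp

lemma bipolyfun_add [intro]: "bipolyfun f \<Longrightarrow> bipolyfun g \<Longrightarrow> bipolyfun (\<lambda>x y. f x y + g x y)"
  unfolding bipolyfun_def by (metis poly_add)

lemma bipolyfun_mult [intro]: "bipolyfun f \<Longrightarrow> bipolyfun g \<Longrightarrow> bipolyfun (\<lambda>x y. f x y * g x y)"
  unfolding bipolyfun_def by (metis poly_mult)

lemma bipolyfun_minus [intro]: "bipolyfun f \<Longrightarrow> bipolyfun (\<lambda>x y. - f x y)"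
  unfolding bipolyfun_def by (metis poly_minus)

lemma bipolyfun_If [intro]: "bipolyfun f \<Longrightarrow> bipolyfun g \<Longrightarrow> bipolyfun (\<lambda>x y. if b then f x y else g x y)"
  by (cases b) simp_all

lemma bipolyfun_peval:
  assumes "\<And>i. bipolyfun (\<lambda>x y. w x y i)"
  shows "bipolyfun (\<lambda>x y. peval h (w x y))"
  by (induction h) (auto intro: assms)

text \<open>No point of the complex plane is isolated: removing finitely many points other than
  \<open>a\<close> leaves a neighbourhood of \<open>a\<close>.\<close>

lemma infinite_eventually_at:
  fixes a :: complex
  assumes "\<forall>\<^sub>F x in at a. P x"
  shows "infinite {x. P x}"
proof
  assume "finite {x. P x}"
  then have "open (- ({x. P x} - {a}))"
    by (intro open_Compl finite_imp_closed) auto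
  then have "\<forall>\<^sub>F x in at a. x \<in> - ({x. P x} - {a})"
    by (rule eventually_at_in_open') simp
  moreover have "\<forall>\<^sub>F x in at a. x \<noteq> a" by (simp add: eventually_at_filter)
  ultimately have "\<forall>\<^sub>F x in at a. False" using assms by eventually_elim auto
  then show False by simp
qed

lemma tendsto_bipoly:
  fixes p :: "complex poly poly"
  assumes "(a \<longlongrightarrow> x) F" "(b \<longlongrightarrow> y) F"
  shows "((\<lambda>d. poly (poly p [:a d:]) (b d)) \<longlongrightarrow> poly (poly p [:x:]) y) F"
  by (induction p)
    (auto intro!: tendsto_intros assms isCont_tendsto_compose[OF poly_isCont])

text \<open>A factor \<open>x\<close> of the polynomial can be cancelled along the arcs; if there is none, letting
  \<open>d \<rightarrow> 0\<close> gives infinitely many zeros on the line \<open>x = 0\<close>.\<close>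

lemma bipoly_vanishes_along_arcs:
  fixes f :: "complex \<Rightarrow> complex \<Rightarrow> complex" and arc :: "complex \<Rightarrow> complex \<Rightarrow> complex"
  assumes f: "bipolyfun f" and A: "infinite A"
    and lim: "\<And>v. v \<in> A \<Longrightarrow> (arc v \<longlongrightarrow> 0) (at 0)"
    and nz: "\<And>v. v \<in> A \<Longrightarrow> \<forall>\<^sub>F d in at 0. arc v d \<noteq> 0"
    and zero: "\<And>v. v \<in> A \<Longrightarrow> \<forall>\<^sub>F d in at 0. f (arc v d) (v + d * arc v d) = 0"
  shows "f x y = 0"
proof -
  obtain p where p: "\<And>x y. f x y = poly (poly p [:x:]) y" using f unfolding bipolyfun_def by blast
  have "\<And>v. v \<in> A \<Longrightarrow> \<forall>\<^sub>F d in at 0. poly (poly p [:arc v d:]) (v + d * arc v d) = 0"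
    using zero p by simp
  then have "p = 0"
  proof (induction p)
    case 0 show ?case ..
  next
    case (pCons a q)
    have "poly a v = 0" if v: "v \<in> A" for v
    proof -
      let ?g = "\<lambda>d. poly a (v + d * arc v d) + arc v d * poly (poly q [:arc v d:]) (v + d * arc v d)"
      have b: "((\<lambda>d. v + d * arc v d) \<longlongrightarrow> v + 0 * 0) (at 0)"
        by (intro tendsto_intros lim v)
      have "(?g \<longlongrightarrow> poly a (v + 0 * 0) + 0 * poly (poly q [:0:]) (v + 0 * 0)) (at 0)"
        by (intro tendsto_add tendsto_mult tendsto_bipoly lim v b isCont_tendsto_compose[OF poly_isCont])
      then have "(?g \<longlongrightarrow> poly a v) (at 0)" by simp
      moreover have "(?g \<longlongrightarrow> 0) (at 0)"
        by (rule tendsto_eventually) (use pCons.prems[OF v] in simp)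
      ultimately show ?thesis using tendsto_unique[OF at_neq_bot] by blast
    qed
    then have "A \<subseteq> {x. poly a x = 0}" by auto
    then have a: "a = 0" using A poly_roots_finite finite_subset by blast
    have "q = 0"
    proof (rule pCons.IH)
      fix v assume v: "v \<in> A"
      show "\<forall>\<^sub>F d in at 0. poly (poly q [:arc v d:]) (v + d * arc v d) = 0"
        using pCons.prems[OF v] nz[OF v] by eventually_elim (simp add: a)
    qed
    with a show ?case by simp
  qed
  then show ?thesis by (simp add: p)
qed

section \<open>Polynomials over Q at rational and complex points\<close>

fun var_bound :: "pexpr \<Rightarrow> nat" where
  "var_bound (Var i) = Suc i"
| "var_bound (Const c) = 0"
| "var_bound (Add p q) = max (var_bound p) (var_bound q)"
| "var_bound (Mul p q) = max (var_bound p) (var_bound q)"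
| "var_bound (Neg p) = var_bound p"

lemma peval_cong: "(\<And>i. i < var_bound p \<Longrightarrow> v i = w i) \<Longrightarrow> peval p v = peval p w"
  by (induction p) auto

lemma peval_of_rat:
  "peval p (\<lambda>i. of_rat (v i) :: 'a::field_char_0) = of_rat (peval p v)"
  by (induction p) (auto simp: of_rat_add of_rat_mult of_rat_minus)

text \<open>Q^n is Zariski dense in C^n. The coordinates are freed from Q one at a time: in each of
  them the value is a polynomial that vanishes at the infinitely many rational numbers.\<close>

lemma peval_vanish_complex:
  fixes v :: "nat \<Rightarrow> complex"
  assumes "\<And>t :: nat \<Rightarrow> rat. peval p t = 0"
  shows "peval p v = 0"
proof -
  have "peval p v = 0" if "\<And>i. i \<ge> n \<Longrightarrow> v i \<in> range of_rat" for n and v :: "nat \<Rightarrow> complex"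
    using that
  proof (induction n arbitrary: v)
    case 0
    then have "\<forall>i. \<exists>c. v i = of_rat c" by auto
    then obtain c where "v = (\<lambda>i. of_rat (c i))" by (metis (mono_tags))
    then show ?case by (simp add: peval_of_rat assms)
  next
    case (Suc n)
    have "peval p (v(n := v n)) = 0"
    proof (rule polyfun_eq_0[where f = "\<lambda>x. peval p (v(n := x))"])
      show "polyfun (\<lambda>x. peval p (v(n := x)))"
      proof (rule polyfun_peval[where w = "\<lambda>x. v(n := x)"])
        fix i show "polyfun (\<lambda>x. (v(n := x)) i)" by (cases "i = n") auto
      qed
      show "infinite (range (of_rat :: rat \<Rightarrow> complex))"
        using finite_imageD[of of_rat "UNIV :: rat set"] infinite_UNIV_char_0 by (auto simp: inj_on_def)
      fix x :: complex assume "x \<in> range of_rat"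
      then show "peval p (v(n := x)) = 0"
        using Suc.prems by (intro Suc.IH) (auto simp: Suc_le_eq)
    qed
    then show ?case by simp
  qed
  \<comment> \<open>Coordinates that do not occur in \<open>p\<close> are reset to the rational
    value 0, so only finitely many have to be freed.\<close>
  from this[of "var_bound p" "\<lambda>i. if i < var_bound p then v i else 0"]
  have "peval p (\<lambda>i. if i < var_bound p then v i else 0) = 0"
    by (auto intro: image_eqI[of _ _ 0])
  then show ?thesis by (subst peval_cong) auto
qed

section \<open>Rational expressions, their numerators and denominators\<close>

datatype rexpr = RVar nat | RConst rat | RAdd rexpr rexpr (infixl "\<oplus>" 65)
  | RMul rexpr rexpr (infixl "\<otimes>" 70) | RDiv rexpr rexpr (infixl "\<oslash>" 70)

fun reval :: "rexpr \<Rightarrow> (nat \<Rightarrow> 'a::field_char_0) \<Rightarrow> 'a" where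
  "reval (RVar i) v = v i"
| "reval (RConst c) v = of_rat c"
| "reval (p \<oplus> q) v = reval p v + reval q v"
| "reval (p \<otimes> q) v = reval p v * reval q v"
| "reval (p \<oslash> q) v = reval p v / reval q v"

text \<open>Since \<open>x / 0 = 0\<close>, \<open>reval\<close> is total; \<open>rok\<close>
  singles out the points where its value is the genuine value of the rational function.\<close>

fun rok :: "rexpr \<Rightarrow> (nat \<Rightarrow> 'a::field_char_0) \<Rightarrow> bool" where
  "rok (RVar i) v = True"
| "rok (RConst c) v = True"
| "rok (p \<oplus> q) v = (rok p v \<and> rok q v)"
| "rok (p \<otimes> q) v = (rok p v \<and> rok q v)"
| "rok (p \<oslash> q) v = (rok p v \<and> rok q v \<and> reval q v \<noteq> 0)"

text \<open>In a quotient the factor \<open>rden q\<close> is not cancelled, so that a nonzero denominator certifies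
  \<open>rok\<close> for all subexpressions.\<close>

fun rnum :: "rexpr \<Rightarrow> pexpr" and rden :: "rexpr \<Rightarrow> pexpr" where
  "rnum (RVar i) = Var i"
| "rnum (RConst c) = Const c"
| "rnum (p \<oplus> q) = Add (Mul (rnum p) (rden q)) (Mul (rnum q) (rden p))"
| "rnum (p \<otimes> q) = Mul (rnum p) (rnum q)"
| "rnum (p \<oslash> q) = Mul (rnum p) (Mul (rden q) (rden q))"
| "rden (RVar i) = Const 1"
| "rden (RConst c) = Const 1"
| "rden (p \<oplus> q) = Mul (rden p) (rden q)"
| "rden (p \<otimes> q) = Mul (rden p) (rden q)"
| "rden (p \<oslash> q) = Mul (rden p) (Mul (rnum q) (rden q))"

lemma reval_frac:
  "(peval (rden e) v \<noteq> 0 \<longleftrightarrow> rok e v) \<and>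
   (rok e v \<longrightarrow> peval (rnum e) v / peval (rden e) v = reval e v)"
  by (induction e) (auto simp: field_simps)

fun rsubst :: "(nat \<Rightarrow> rexpr) \<Rightarrow> pexpr \<Rightarrow> rexpr" where
  "rsubst \<sigma> (Var i) = \<sigma> i"
| "rsubst \<sigma> (Const c) = RConst c"
| "rsubst \<sigma> (Add p q) = rsubst \<sigma> p \<oplus> rsubst \<sigma> q"
| "rsubst \<sigma> (Mul p q) = rsubst \<sigma> p \<otimes> rsubst \<sigma> q"
| "rsubst \<sigma> (Neg p) = RConst (-1) \<otimes> rsubst \<sigma> p"

lemma reval_rsubst: "reval (rsubst \<sigma> p) v = peval p (\<lambda>i. reval (\<sigma> i) v)"
  by (induction p) (auto simp: of_rat_minus)

lemma rok_rsubst: "(\<And>i. rok (\<sigma> i) v) \<Longrightarrow> rok (rsubst \<sigma> p) v"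
  by (induction p) auto

text \<open>Transfers vanishing on the image from rational to complex parameters. The pullback of
  \<open>g\<close> is only a rational function, so its numerator is multiplied by all denominators
  of the map; this product vanishes at every rational parameter, defined or not, and density of Q
  applies to it.\<close>

lemma peval_rmap_complex:
  fixes v :: "nat \<Rightarrow> complex"
  assumes zero: "\<And>t. rdefined (\<lambda>i. rden (\<sigma> i)) t \<Longrightarrow>
      peval g (rmap (\<lambda>i. rnum (\<sigma> i)) (\<lambda>i. rden (\<sigma> i)) t) = 0"
    and \<sigma>: "\<And>i. i \<ge> 7 \<Longrightarrow> \<sigma> i = RConst 0" and ok: "\<And>i. rok (\<sigma> i) v"
  shows "peval g (\<lambda>i. reval (\<sigma> i) v) = 0"
proof -
  define e where "e = rsubst \<sigma> g"
  \<comment> \<open>The product of the seven denominators; its nonvanishing is characterised over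
    any field, as it is needed over Q and over C.\<close>
  define q where "q = foldr (\<lambda>i p. Mul (rden (\<sigma> i)) p) [0..<7] (Const 1)"
  have q: "peval q t \<noteq> 0 \<longleftrightarrow> (\<forall>i<7. rok (\<sigma> i) t)" for t :: "nat \<Rightarrow> 'b::field_char_0"
  proof -
    have "peval (foldr (\<lambda>i p. Mul (rden (\<sigma> i)) p) is (Const 1)) t \<noteq> 0 \<longleftrightarrow> (\<forall>i\<in>set is. rok (\<sigma> i) t)" for "is"
      by (induction "is") (auto simp: reval_frac)
    from this[of "[0..<7]"] show ?thesis by (auto simp: q_def)
  qed
  have "peval (Mul (rnum e) q) t = 0" for t :: "nat \<Rightarrow> rat"
  proof (cases "\<forall>i<7. rok (\<sigma> i) t")
    case False
    then show ?thesis using q[of t] by auto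
  next
    case True
    then have ok: "rok (\<sigma> i) t" for i using \<sigma>[of i] by (cases "i < 7") auto
    have "rmap (\<lambda>i. rnum (\<sigma> i)) (\<lambda>i. rden (\<sigma> i)) t = (\<lambda>i. reval (\<sigma> i) t)"
      using ok \<sigma> by (auto simp: rmap_def reval_frac)
    then have "peval g (\<lambda>i. reval (\<sigma> i) t) = 0"
      using zero[of t] ok by (simp add: rdefined_def reval_frac)
    then have "reval e t = 0" by (simp add: e_def reval_rsubst)
    then show ?thesis using reval_frac[of e t] rok_rsubst[OF ok, where p = g] by (auto simp: e_def)
  qed
  then have "peval (Mul (rnum e) q) v = 0" by (rule peval_vanish_complex)
  then have "peval (rnum e) v = 0" using q[of v] ok by auto
  then show ?thesis using reval_frac[of e v] rok_rsubst[OF ok, where p = g] by (simp add: e_def reval_rsubst)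
qed

section \<open>The rational map\<close>

abbreviation rdiff :: "rexpr \<Rightarrow> rexpr \<Rightarrow> rexpr" (infixl "\<ominus>" 65) where
  "p \<ominus> q \<equiv> p \<oplus> RConst (-1) \<otimes> q"
abbreviation rsq :: "rexpr \<Rightarrow> rexpr" where "rsq p \<equiv> p \<otimes> p"

text \<open>On the slice \<open>u = 0\<close> put \<open>m = P - R\<close>, \<open>w = P + R\<close>. The equation is
  \<open>y\<^sup>2 = (1 - m\<^sup>2) w\<^sup>2 - (1 - m\<^sup>2) - 1\<close>; once \<open>1 - m\<^sup>2 = n\<^sup>2\<close> it reads \<open>(n w - y) (n w + y) = 1 + n\<^sup>2\<close>.
  Variable 0 parametrises the circle, variable 1 is \<open>n w - y\<close>, and variable 2 is the direction \<open>d\<close>.\<close>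

definition "mR = (RConst 2 \<otimes> RVar 0) \<oslash> (RConst 1 \<oplus> rsq (RVar 0))"
definition "nR = (RConst 1 \<ominus> rsq (RVar 0)) \<oslash> (RConst 1 \<oplus> rsq (RVar 0))"
definition "wR = ((RConst 1 \<oplus> rsq nR) \<oslash> RVar 1 \<oplus> RVar 1) \<oslash> (RConst 2 \<otimes> nR)"
definition "yR = ((RConst 1 \<oplus> rsq nR) \<oslash> RVar 1 \<ominus> RVar 1) \<oslash> RConst 2"
definition "vR = wR \<ominus> mR"
definition "tR = (wR \<oplus> mR) \<oslash> vR"
definition "cR = (rsq tR \<oplus> RConst 1) \<oslash> RConst 2"
definition "kR = (rsq tR \<ominus> RConst 1) \<oslash> RConst 4"
definition "eR = RConst 2 \<otimes> rsq kR \<ominus> rsq tR"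
definition "sliceR = cR \<otimes> rsq vR \<ominus> rsq (kR \<otimes> rsq vR) \<ominus> RConst 2"
definition "slice'R = RConst 2 \<otimes> cR \<otimes> vR \<ominus> RConst 4 \<otimes> rsq kR \<otimes> (vR \<otimes> rsq vR)"
definition "quadR = RConst 4 \<otimes> sliceR \<otimes>
    (rsq (RVar 2) \<otimes> (cR \<ominus> RConst 6 \<otimes> rsq kR \<otimes> rsq vR) \<oplus> cR \<oplus> eR \<otimes> rsq vR)
    \<ominus> rsq (RVar 2) \<otimes> rsq slice'R"
definition "step_numR = RConst 8 \<otimes> sliceR \<otimes> (slice'R \<otimes> quadR
    \<ominus> RConst 8 \<otimes> rsq sliceR \<otimes> (RConst 2 \<otimes> eR \<otimes> vR \<ominus> RConst 4 \<otimes> rsq kR \<otimes> vR \<otimes> rsq (RVar 2)))"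
definition "step_denR = RConst 64 \<otimes> (sliceR \<otimes> rsq sliceR) \<otimes>
    (eR \<otimes> rsq (RVar 2) \<ominus> rsq kR \<ominus> rsq kR \<otimes> rsq (rsq (RVar 2))) \<ominus> rsq quadR"
definition "stepR = RVar 2 \<otimes> step_numR \<oslash> step_denR"
definition "yratioR = RConst 1 \<oplus> RVar 2 \<otimes> slice'R \<otimes> stepR \<oslash> (RConst 2 \<otimes> sliceR)
    \<oplus> quadR \<otimes> rsq stepR \<oslash> (RConst 8 \<otimes> rsq sliceR)"
definition "v1R = vR \<oplus> RVar 2 \<otimes> stepR"
definition "y1R = yR \<otimes> yratioR"

definition coordR :: "nat \<Rightarrow> rexpr" where
  "coordR = (\<lambda>_. RConst 0)(
     0 := (RConst 1 \<oplus> tR \<otimes> stepR \<otimes> v1R) \<oslash> RConst 2,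
     1 := (RConst 1 \<oplus> kR \<otimes> (rsq v1R \<ominus> rsq stepR)) \<oslash> RConst 2,
     2 := y1R \<oslash> RConst 2,
     3 := (tR \<otimes> v1R \<oplus> stepR) \<oslash> RConst 2,
     4 := (tR \<otimes> v1R \<ominus> stepR) \<oslash> RConst 2,
     5 := (v1R \<oplus> tR \<otimes> stepR) \<oslash> RConst 2,
     6 := (v1R \<ominus> tR \<otimes> stepR) \<oslash> RConst 2)"

section \<open>Values and domain of definition of the map\<close>

context
  fixes p :: "nat \<Rightarrow> 'a::field_char_0"
begin

lemma reval_base:
  "reval mR p = 2 * p 0 / (1 + (p 0)^2)"
  "reval nR p = (1 - (p 0)^2) / (1 + (p 0)^2)"
  "reval wR p = ((1 + (reval nR p)^2) / p 1 + p 1) / (2 * reval nR p)"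
  "reval yR p = ((1 + (reval nR p)^2) / p 1 - p 1) / 2"
  "reval vR p = reval wR p - reval mR p"
  "reval tR p = (reval wR p + reval mR p) / reval vR p"
  by (simp_all add: mR_def nR_def wR_def yR_def vR_def tR_def power2_eq_square of_rat_minus)

lemma reval_coef:
  "reval cR p = ccoef (reval tR p)"
  "reval kR p = kcoef (reval tR p)"
  "reval eR p = ecoef (reval tR p)"
  by (simp_all add: cR_def kR_def eR_def ccoef_def kcoef_def ecoef_def power2_eq_square of_rat_minus)

lemma reval_step:
  "reval sliceR p = slice (reval tR p) (reval vR p)"
  "reval slice'R p = slice' (reval tR p) (reval vR p)"
  "reval quadR p = quad (reval tR p) (reval vR p) (p 2)"
  "reval step_numR p = step_num (reval tR p) (reval vR p) (p 2)"
  "reval step_denR p = step_den (reval tR p) (reval vR p) (p 2)"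
  "reval stepR p = step (reval tR p) (reval vR p) (p 2)"
  "reval yratioR p = yratio (reval tR p) (reval vR p) (p 2)"
proof -
  have pow: "x^2 = x * x" "x^3 = x * (x * x)" "x^4 = (x * x) * (x * x)" for x :: 'a
    by (simp_all add: power2_eq_square power3_eq_cube power4_eq_xxxx)
  show 1: "reval sliceR p = slice (reval tR p) (reval vR p)"
    by (simp add: sliceR_def slice_def reval_coef pow of_rat_minus)
  show 2: "reval slice'R p = slice' (reval tR p) (reval vR p)"
    by (simp add: slice'R_def slice'_def reval_coef pow of_rat_minus)
  show 3: "reval quadR p = quad (reval tR p) (reval vR p) (p 2)"
    by (simp add: quadR_def quad_def reval_coef 1 2 pow of_rat_minus)
  show 4: "reval step_numR p = step_num (reval tR p) (reval vR p) (p 2)"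
    by (simp add: step_numR_def step_num_def reval_coef 1 2 3 pow of_rat_minus)
  show 5: "reval step_denR p = step_den (reval tR p) (reval vR p) (p 2)"
    by (simp add: step_denR_def step_den_def reval_coef 1 2 3 pow of_rat_minus)
  show 6: "reval stepR p = step (reval tR p) (reval vR p) (p 2)"
    by (simp add: stepR_def step_def 4 5)
  show "reval yratioR p = yratio (reval tR p) (reval vR p) (p 2)"
    by (simp add: yratioR_def yratio_def 1 2 3 6 pow)
qed

lemma reval_coordR:
  "reval (coordR i) p = chart (reval tR p) (step (reval tR p) (reval vR p) (p 2))
     (reval vR p + p 2 * step (reval tR p) (reval vR p) (p 2))
     (reval yR p * yratio (reval tR p) (reval vR p) (p 2)) i"
  by (simp add: coordR_def chart_def v1R_def y1R_def reval_coef reval_step power2_eq_square of_rat_minus)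

lemma rok_coordR:
  "(\<forall>i<7. rok (coordR i) p) \<longleftrightarrow>
     1 + (p 0)^2 \<noteq> 0 \<and> p 1 \<noteq> 0 \<and> reval nR p \<noteq> 0 \<and> reval vR p \<noteq> 0 \<and>
     slice (reval tR p) (reval vR p) \<noteq> 0 \<and> step_den (reval tR p) (reval vR p) (p 2) \<noteq> 0"
  (is "?L \<longleftrightarrow> ?R")
proof -
  have base: "rok mR p \<longleftrightarrow> 1 + (p 0)^2 \<noteq> 0" "rok nR p \<longleftrightarrow> 1 + (p 0)^2 \<noteq> 0"
    "rok wR p \<longleftrightarrow> 1 + (p 0)^2 \<noteq> 0 \<and> p 1 \<noteq> 0 \<and> reval nR p \<noteq> 0"
    "rok yR p \<longleftrightarrow> 1 + (p 0)^2 \<noteq> 0 \<and> p 1 \<noteq> 0"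
    "rok vR p \<longleftrightarrow> rok wR p" "rok tR p \<longleftrightarrow> rok wR p \<and> reval vR p \<noteq> 0"
    by (auto simp: mR_def nR_def wR_def yR_def vR_def tR_def power2_eq_square)
  have mid: "rok cR p \<longleftrightarrow> rok tR p" "rok kR p \<longleftrightarrow> rok tR p" "rok eR p \<longleftrightarrow> rok tR p"
    "rok sliceR p \<longleftrightarrow> rok tR p" "rok slice'R p \<longleftrightarrow> rok tR p" "rok quadR p \<longleftrightarrow> rok tR p"
    "rok step_numR p \<longleftrightarrow> rok tR p" "rok step_denR p \<longleftrightarrow> rok tR p"
    by (auto simp: cR_def kR_def eR_def sliceR_def slice'R_def quadR_def step_numR_def step_denR_def
        base(5,6))
  have top: "rok stepR p \<longleftrightarrow> rok tR p \<and> step_den (reval tR p) (reval vR p) (p 2) \<noteq> 0"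
    "rok yratioR p \<longleftrightarrow> rok stepR p \<and> slice (reval tR p) (reval vR p) \<noteq> 0"
    "rok v1R p \<longleftrightarrow> rok stepR p" "rok y1R p \<longleftrightarrow> rok yratioR p"
    by (auto simp: stepR_def yratioR_def v1R_def y1R_def mid reval_step base)
  have all: "rok (coordR i) p" if "rok yratioR p" for i
    using that by (auto simp: coordR_def top mid fun_upd_apply)
  \<comment> \<open>Coordinate 2 contains \<open>yratioR\<close>, in which every division of the
    other coordinates (apart from constants) already occurs, so it decides where the map is
    defined.\<close>
  have "rok (coordR 2) p \<longleftrightarrow> rok yratioR p"
    by (simp add: coordR_def top)
  then have "?L \<longleftrightarrow> rok yratioR p" using all by fastforce
  also have "\<dots> \<longleftrightarrow> ?R" by (auto simp: top base)
  finally show ?thesis .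
qed

end

section \<open>Points of the slice and their parameters\<close>

lemma circle_param:
  fixes s :: "'a::field_char_0"
  assumes "1 + s^2 \<noteq> 0"
  shows "(2 * s / (1 + s^2))^2 + ((1 - s^2) / (1 + s^2))^2 = 1"
  using assms by (simp add: field_simps) algebra

lemma hyperbola_param:
  fixes r :: "'a::field_char_0"
  assumes "r \<noteq> 0" "n \<noteq> 0"
  shows "((a / r - r) / 2)^2 = n^2 * ((a / r + r) / (2 * n))^2 - a"
  using assms by (simp add: field_simps power2_eq_square)

lemma slice_point:
  fixes p :: "nat \<Rightarrow> 'a::field_char_0"
  assumes "1 + (p 0)^2 \<noteq> 0" "p 1 \<noteq> 0" "reval nR p \<noteq> 0" "reval vR p \<noteq> 0"
  shows "(reval yR p)^2 = slice (reval tR p) (reval vR p)"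
proof -
  have 1: "(reval mR p)^2 + (reval nR p)^2 = 1"
    using circle_param[OF assms(1)] by (simp add: reval_base(1,2))
  have 2: "(reval yR p)^2 = (reval nR p)^2 * (reval wR p)^2 - (1 + (reval nR p)^2)"
    unfolding reval_base(3,4) by (rule hyperbola_param) (use assms in auto)
  have 3: "slice (reval tR p) (reval vR p)
      = (reval wR p)^2 + (reval mR p)^2 - (reval wR p * reval mR p)^2 - 2"
    by (rule slice_eq) (use assms(4) in \<open>simp_all add: reval_base(5,6)\<close>)
  show ?thesis unfolding 2 3 using 1 by algebra
qed

lemma coordR_in_V:
  fixes p :: "nat \<Rightarrow> 'a::field_char_0"
  assumes "\<And>i. i < 7 \<Longrightarrow> rok (coordR i) p"
  shows "in_V (\<lambda>i. reval (coordR i) p)"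
proof -
  have R: "1 + (p 0)^2 \<noteq> 0" "p 1 \<noteq> 0" "reval nR p \<noteq> 0" "reval vR p \<noteq> 0"
     "slice (reval tR p) (reval vR p) \<noteq> 0" "step_den (reval tR p) (reval vR p) (p 2) \<noteq> 0"
    using assms rok_coordR[of p] by blast+
  show ?thesis unfolding reval_coordR
    using chart_in_V[OF quartic_step[OF R(5,6) slice_point[OF R(1-4)]]] by simp
qed

text \<open>Inverts the parametrisation over C, where \<open>n\<close> exists as a square root of
  \<open>1 - m^2\<close>. The excluded values guard its divisions: \<open>m \<noteq> 0\<close> gives
  \<open>n \<noteq> -1\<close>, \<open>m^2 \<noteq> 1\<close> gives \<open>n \<noteq> 0\<close>, and
  \<open>m^2 \<noteq> 2\<close> gives \<open>1 + n^2 \<noteq> 0\<close>, hence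
  \<open>r \<noteq> 0\<close>.\<close>

lemma coordR_attains:
  fixes t v y d :: complex
  assumes t: "t \<noteq> 1" and v: "v \<noteq> 0" and m1: "((t - 1) * v / 2)^2 \<noteq> 1" and m2: "((t - 1) * v / 2)^2 \<noteq> 2"
    and y: "y^2 = slice t v" and f: "slice t v \<noteq> 0" and den: "step_den t v d \<noteq> 0"
  obtains p where "\<And>i. i < 7 \<Longrightarrow> rok (coordR i) p"
    "(\<lambda>i. reval (coordR i) p) = chart t (step t v d) (v + d * step t v d) (y * yratio t v d)"
proof -
  define m where "m = (t - 1) * v / 2"
  define w where "w = (t + 1) * v / 2"
  define n where "n = csqrt (1 - m^2)"
  have n2: "n^2 = 1 - m^2" by (simp add: n_def)
  have n0: "n \<noteq> 0" using n2 m1 by (auto simp: m_def)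
  have m0: "m \<noteq> 0" using t v by (simp add: m_def)
  have n1: "1 + n \<noteq> 0"
  proof
    assume "1 + n = 0"
    then have "n = -1" by algebra
    then show False using n2 m0 by simp
  qed
  have nn: "1 + n^2 \<noteq> 0" using n2 m2 by (auto simp: m_def)
  \<comment> \<open>Stereographic projection of \<open>(m, n)\<close> from \<open>(0, -1)\<close>,
    and the linear factor \<open>n w - y\<close> of the hyperbola.\<close>
  define s where "s = m / (1 + n)"
  define r where "r = n * w - y"
  have s2: "1 + s^2 = 2 / (1 + n)" using n1 n2 by (simp add: s_def field_simps) algebra
  have s0: "1 + s^2 \<noteq> 0" using n1 s2 by simp
  have sm: "2 * s / (1 + s^2) = m" unfolding s2 using n1 by (simp add: s_def)
  have sn: "(1 - s^2) / (1 + s^2) = n"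
  proof -
    have "1 - s^2 = 2 - (1 + s^2)" by simp
    also have "\<dots> = n * (1 + s^2)" unfolding s2 using n1 by (simp add: field_simps)
    finally show ?thesis using s0 by simp
  qed
  have vw: "v = w - m" "t * v = w + m" by (simp_all add: w_def m_def field_simps)
  have "y^2 = w^2 + m^2 - (w * m)^2 - 2" unfolding y by (rule slice_eq[OF vw(2,1)])
  then have rr: "1 + n^2 = (n * w + y) * r" unfolding r_def using n2 by algebra
  then have r0: "r \<noteq> 0" using nn by auto
  then have r: "(1 + n^2) / r = n * w + y" unfolding rr by simp
  define p :: "nat \<Rightarrow> complex" where "p = (\<lambda>_. 0)(0 := s, 1 := r, 2 := d)"
  have p: "p 0 = s" "p 1 = r" "p 2 = d" by (simp_all add: p_def)
  have R: "reval mR p = m" "reval nR p = n"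
    by (simp_all add: reval_base(1,2) p sm sn)
  have R3: "reval wR p = w" "reval yR p = y"
    unfolding reval_base(3,4) R p r using n0 by (simp_all add: r_def)
  have R5: "reval vR p = v" by (simp add: reval_base(5) R R3 vw(1))
  have R6: "reval tR p = t" using v by (simp add: reval_base(6) R R3 R5 vw(2)[symmetric])
  show thesis
  proof (rule that)
    show "(\<lambda>i. reval (coordR i) p) = chart t (step t v d) (v + d * step t v d) (y * yratio t v d)"
      by (rule ext) (simp add: reval_coordR R R3 R5 R6 p)
    have "\<forall>i<7. rok (coordR i) p"
      unfolding rok_coordR R R3 R5 R6 p using s0 r0 n0 v f den by simp
    then show "\<And>i. i < 7 \<Longrightarrow> rok (coordR i) p" by blast
  qed
qed

section \<open>Density of the image\<close>

text \<open>The conditions on \<open>t\<close> say that those on \<open>v\<close> hold near \<open>v = 0\<close>.\<close>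

definition good_t :: "complex set" where
  "good_t = {t. t \<noteq> 1 \<and> (ccoef t)^2 + 4 * ecoef t \<noteq> 0 \<and> (ccoef t)^2 - 8 * (kcoef t)^2 \<noteq> 0}"

text \<open>The conditions of \<open>coordR_attains\<close> on \<open>v\<close> at
  \<open>d = 0\<close>, together with \<open>step_num t v 0 \<noteq> 0\<close>, which makes
  \<open>step t v d\<close> vanish to exactly first order in \<open>d\<close>: the arc crosses
  \<open>u = 0\<close> transversally.\<close>

definition good_v :: "complex \<Rightarrow> complex set" where
  "good_v t = {v. v \<noteq> 0 \<and> ((t - 1) * v / 2)^2 \<noteq> 1 \<and> ((t - 1) * v / 2)^2 \<noteq> 2 \<and> slice t v \<noteq> 0 \<and>
     step_num t v 0 \<noteq> 0 \<and> step_den t v 0 \<noteq> 0}"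

lemma infinite_good_t: "infinite good_t"
proof -
  \<comment> \<open>The test value is \<open>t = 0\<close>, where the two expressions in
    \<open>good_t\<close> equal 3/4 and -1/4.\<close>
  have c: "((\<lambda>t::complex. ccoef t) \<longlongrightarrow> 1/2) (at 0)" unfolding ccoef_def by (auto intro!: tendsto_eq_intros)
  have k: "((\<lambda>t::complex. kcoef t) \<longlongrightarrow> -1/4) (at 0)" unfolding kcoef_def by (auto intro!: tendsto_eq_intros)
  have e: "((\<lambda>t::complex. ecoef t) \<longlongrightarrow> 1/8) (at 0)"
    unfolding ecoef_def by (rule tendsto_eq_intros k refl | simp add: power2_eq_square)+
  have "\<forall>\<^sub>F t::complex in at 0. t - 1 \<noteq> 0"
    by (rule tendsto_imp_eventually_ne[where c = "-1"]) (auto intro!: tendsto_eq_intros)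
  moreover have "\<forall>\<^sub>F t::complex in at 0. (ccoef t)^2 + 4 * ecoef t \<noteq> 0"
    by (rule tendsto_imp_eventually_ne, (rule tendsto_intros c e)+) (simp add: power2_eq_square)
  moreover have "\<forall>\<^sub>F t::complex in at 0. (ccoef t)^2 - 8 * (kcoef t)^2 \<noteq> 0"
    by (rule tendsto_imp_eventually_ne, (rule tendsto_intros c k)+) (simp add: power2_eq_square)
  ultimately have "\<forall>\<^sub>F t::complex in at 0. t \<noteq> 1 \<and> (ccoef t)^2 + 4 * ecoef t \<noteq> 0 \<and>
      (ccoef t)^2 - 8 * (kcoef t)^2 \<noteq> 0"
    by eventually_elim auto
  then show ?thesis unfolding good_t_def by (rule infinite_eventually_at)
qed

text \<open>As \<open>v\<close> tends to 0 the last bracket tends to the first expression in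
  \<open>good_t\<close>.\<close>

lemma step_num_0:
  "step_num t v 0 = 64 * (slice t v)^2 * v *
     ((ccoef t)^2 + 4 * ecoef t - ccoef t * (ecoef t + 2 * (kcoef t)^2) * v^2)"
  unfolding step_num_def quad_def slice'_def slice_def by simp algebra

text \<open>As \<open>v\<close> tends to 0, \<open>slice t v\<close> tends to -2 and the last
  bracket tends to the second expression in \<open>good_t\<close>.\<close>

lemma step_den_0:
  "step_den t v 0 = - 16 * (slice t v)^2 * (4 * slice t v * (kcoef t)^2 + (ccoef t + ecoef t * v^2)^2)"
  unfolding step_den_def quad_def by simp algebra

lemma infinite_good_v:
  assumes "t \<in> good_t"
  shows "infinite (good_v t)"
proof -
  have s: "((\<lambda>v. slice t v) \<longlongrightarrow> -2) (at 0)" unfolding slice_def by (auto intro!: tendsto_eq_intros)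
  have 1: "\<forall>\<^sub>F v::complex in at 0. v \<noteq> 0" by (simp add: eventually_at_filter)
  have 2: "\<forall>\<^sub>F v in at 0. ((t - 1) * v / 2)^2 - 1 \<noteq> 0"
    by (rule tendsto_imp_eventually_ne, (rule tendsto_intros)+) auto
  have 3: "\<forall>\<^sub>F v in at 0. ((t - 1) * v / 2)^2 - 2 \<noteq> 0"
    by (rule tendsto_imp_eventually_ne, (rule tendsto_intros)+) auto
  have 4: "\<forall>\<^sub>F v in at 0. slice t v \<noteq> 0"
    by (rule tendsto_imp_eventually_ne[OF s]) simp
  have 5: "\<forall>\<^sub>F v in at 0.
      (ccoef t)^2 + 4 * ecoef t - ccoef t * (ecoef t + 2 * (kcoef t)^2) * v^2 \<noteq> 0"
    by (rule tendsto_imp_eventually_ne, (rule tendsto_intros)+) (use assms in \<open>auto simp: good_t_def\<close>)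
  have 6: "\<forall>\<^sub>F v in at 0. 4 * slice t v * (kcoef t)^2 + (ccoef t + ecoef t * v^2)^2 \<noteq> 0"
    by (rule tendsto_imp_eventually_ne, (rule tendsto_intros s)+) (use assms in \<open>auto simp: good_t_def\<close>)
  have "\<forall>\<^sub>F v in at 0. v \<noteq> 0 \<and> ((t - 1) * v / 2)^2 \<noteq> 1 \<and> ((t - 1) * v / 2)^2 \<noteq> 2 \<and> slice t v \<noteq> 0 \<and>
     step_num t v 0 \<noteq> 0 \<and> step_den t v 0 \<noteq> 0"
    using 1 2 3 4 5 6 by eventually_elim (simp add: step_num_0 step_den_0)
  then show ?thesis unfolding good_v_def by (rule infinite_eventually_at)
qed

lemma step_arc:
  assumes "v \<in> good_v t"
  shows "(step t v \<longlongrightarrow> 0) (at 0)" "\<forall>\<^sub>F d in at 0. step t v d \<noteq> 0"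
    and "\<forall>\<^sub>F d in at 0. step_den t v d \<noteq> 0"
proof -
  have q: "(quad t v \<longlongrightarrow> quad t v 0) (at 0)"
    unfolding quad_def by (rule tendsto_intros)+
  have n: "(step_num t v \<longlongrightarrow> step_num t v 0) (at 0)"
    unfolding step_num_def by (rule tendsto_intros q)+
  have d: "(step_den t v \<longlongrightarrow> step_den t v 0) (at 0)"
    unfolding step_den_def by (rule tendsto_intros q)+
  have nz: "step_num t v 0 \<noteq> 0" "step_den t v 0 \<noteq> 0" using assms by (auto simp: good_v_def)
  have "((\<lambda>d. d * step_num t v d / step_den t v d) \<longlongrightarrow> 0 * step_num t v 0 / step_den t v 0) (at 0)"
    by (intro tendsto_intros n d nz)
  then show "(step t v \<longlongrightarrow> 0) (at 0)" by (simp add: step_def[abs_def])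
  show den: "\<forall>\<^sub>F d in at 0. step_den t v d \<noteq> 0" by (rule tendsto_imp_eventually_ne[OF d nz(2)])
  have "\<forall>\<^sub>F d::complex in at 0. d \<noteq> 0" by (simp add: eventually_at_filter)
  then show "\<forall>\<^sub>F d in at 0. step t v d \<noteq> 0"
    using den tendsto_imp_eventually_ne[OF n nz(1)] by eventually_elim (simp add: step_def)
qed

text \<open>For fixed good \<open>t\<close> the arcs force \<open>f t\<close> to vanish in
  \<open>(u, v)\<close>; then for fixed \<open>(u, v)\<close> there are infinitely many zeros in
  \<open>t\<close>.\<close>

lemma vanishes_on_chart:
  assumes uv: "\<And>t. bipolyfun (f t)" and t: "\<And>u v. polyfun (\<lambda>t. f t u v)"
    and zero: "\<And>t v d. t \<in> good_t \<Longrightarrow> v \<in> good_v t \<Longrightarrow> step_den t v d \<noteq> 0 \<Longrightarrow>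
      f t (step t v d) (v + d * step t v d) = 0"
  shows "f t u v = 0"
proof (rule polyfun_eq_0[OF t infinite_good_t])
  fix t assume T: "t \<in> good_t"
  show "f t u v = 0"
  proof (rule bipoly_vanishes_along_arcs[OF uv infinite_good_v[OF T], of "\<lambda>v. step t v"])
    fix v assume v: "v \<in> good_v t"
    show "(step t v \<longlongrightarrow> 0) (at 0)" "\<forall>\<^sub>F d in at 0. step t v d \<noteq> 0" using step_arc[OF v] by blast+
    show "\<forall>\<^sub>F d in at 0. f t (step t v d) (v + d * step t v d) = 0"
      using step_arc(3)[OF v] by eventually_elim (rule zero[OF T v])
  qed
qed

lemma polyfun_chart: "polyfun (\<lambda>t. chart t u v 0 i)" for u :: "'a::field_char_0"
proof -
  \<comment> \<open>Rewritten with sums, products, negation and constants only, to fit the closure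
    rules.\<close>
  have "chart t u v 0 i = (if i = 0 then (1/2) + (1/2) * (t * u * v)
      else if i = 1 then (1/2) + (1/8) * ((t * t + -1) * (v * v + - (u * u)))
      else if i = 3 then (1/2) * (t * v + u) else if i = 4 then (1/2) * (t * v + - u)
      else if i = 5 then (1/2) * (v + t * u) else if i = 6 then (1/2) * (v + - (t * u)) else 0)" for t
    by (simp add: chart_def kcoef_def field_simps power2_eq_square)
  moreover have "polyfun (\<lambda>t. if i = 0 then (1/2) + (1/2) * (t * u * v)
      else if i = 1 then (1/2) + (1/8) * ((t * t + -1) * (v * v + - (u * u)))
      else if i = 3 then (1/2) * (t * v + u) else if i = 4 then (1/2) * (t * v + - u)
      else if i = 5 then (1/2) * (v + t * u) else if i = 6 then (1/2) * (v + - (t * u)) else 0)"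
    by (intro polyfun_If polyfun_const polyfun_id polyfun_add polyfun_mult polyfun_minus)
  ultimately show ?thesis by simp
qed

lemma bipolyfun_chart: "bipolyfun (\<lambda>u v. chart t u v 0 i)" for t :: "'a::field_char_0"
proof -
  have "chart t u v 0 i = (if i = 0 then (1/2) + (1/2) * (t * u * v)
      else if i = 1 then (1/2) + (1/2) * (kcoef t * (v * v + - (u * u)))
      else if i = 3 then (1/2) * (t * v + u) else if i = 4 then (1/2) * (t * v + - u)
      else if i = 5 then (1/2) * (v + t * u) else if i = 6 then (1/2) * (v + - (t * u)) else 0)" for u v
    by (simp add: chart_def field_simps power2_eq_square)
  moreover have "bipolyfun (\<lambda>u v. if i = 0 then (1/2) + (1/2) * (t * u * v)
      else if i = 1 then (1/2) + (1/2) * (kcoef t * (v * v + - (u * u)))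
      else if i = 3 then (1/2) * (t * v + u) else if i = 4 then (1/2) * (t * v + - u)
      else if i = 5 then (1/2) * (v + t * u) else if i = 6 then (1/2) * (v + - (t * u)) else 0)"
    by (intro bipolyfun_If bipolyfun_const bipolyfun_fst bipolyfun_snd bipolyfun_add bipolyfun_mult bipolyfun_minus)
  ultimately show ?thesis by simp
qed

section \<open>Eliminating z, and the points missed by the chart\<close>

definition zsquare :: pexpr where
  "zsquare = Add (Mul (Var 3) (Var 3)) (Neg (Add (Mul (Var 0) (Var 0)) (Mul (Var 1) (Var 1))))"

lemma peval_zsquare: "peval zsquare w = (w 3)^2 - (w 0)^2 - (w 1)^2"
  by (simp add: zsquare_def power2_eq_square)

text \<open>On V the square of z equals \<open>zsquare\<close>, which does not involve z, so regular
  functions reduce to degree at most 1 in z; the product case multiplies as in a quadratic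
  extension.\<close>

lemma split_off_z:
  obtains a b where
    "\<And>w z. peval a (w(2 := z :: 'a)) = peval a w" "\<And>w z. peval b (w(2 := z :: 'a)) = peval b w"
    "\<And>w :: nat \<Rightarrow> 'a::field_char_0. in_V w \<Longrightarrow> peval g w = peval a w + w 2 * peval b w"
proof -
  let ?free = "\<lambda>a. \<forall>w :: nat \<Rightarrow> 'a. \<forall>z. peval a (w(2 := z)) = peval a w"
  have "\<exists>a b. ?free a \<and> ?free b \<and>
      (\<forall>w :: nat \<Rightarrow> 'a. in_V w \<longrightarrow> peval g w = peval a w + w 2 * peval b w)"
  proof (induction g)
    case (Var i)
    show ?case
    proof (cases "i = 2")
      case True
      show ?thesis by (rule exI[of _ "Const 0"], rule exI[of _ "Const 1"]) (use True in simp)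
    next
      case False
      show ?thesis by (rule exI[of _ "Var i"], rule exI[of _ "Const 0"]) (use False in simp)
    qed
  next
    case (Const c)
    show ?case by (rule exI[of _ "Const c"], rule exI[of _ "Const 0"]) simp
  next
    case (Add p q)
    then obtain a b a' b' where * : "?free a" "?free b" "?free a'" "?free b'"
      "\<forall>w :: nat \<Rightarrow> 'a. in_V w \<longrightarrow> peval p w = peval a w + w 2 * peval b w"
      "\<forall>w :: nat \<Rightarrow> 'a. in_V w \<longrightarrow> peval q w = peval a' w + w 2 * peval b' w" by blast
    show ?case
      by (rule exI[of _ "Add a a'"], rule exI[of _ "Add b b'"])
        (intro conjI allI impI; simp only: peval.simps * distrib_left ac_simps)
  next
    case (Mul p q)
    then obtain a b a' b' where *: "?free a" "?free b" "?free a'" "?free b'"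
      "\<forall>w :: nat \<Rightarrow> 'a. in_V w \<longrightarrow> peval p w = peval a w + w 2 * peval b w"
      "\<forall>w :: nat \<Rightarrow> 'a. in_V w \<longrightarrow> peval q w = peval a' w + w 2 * peval b' w" by blast
    have **: "peval (Mul p q) w = peval (Add (Mul a a') (Mul zsquare (Mul b b'))) w
        + w 2 * peval (Add (Mul a b') (Mul b a')) w" if "in_V w" for w :: "nat \<Rightarrow> 'a"
    proof -
      have z: "(w 2)^2 = peval zsquare w"
        using that unfolding in_V_def peval_zsquare by algebra
      have pq: "peval p w = peval a w + w 2 * peval b w" "peval q w = peval a' w + w 2 * peval b' w"
        using that *(5,6) by blast+
      show ?thesis unfolding peval.simps pq z[symmetric] by algebra
    qed
    have zf: "?free zsquare" by (simp add: peval_zsquare)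
    have "?free (Add (Mul a a') (Mul zsquare (Mul b b')))" "?free (Add (Mul a b') (Mul b a'))"
      by (intro allI; simp only: peval.simps *(1-4) zf)+
    with ** show ?case by blast
  next
    case (Neg p)
    then obtain a b where * : "?free a" "?free b"
      "\<forall>w :: nat \<Rightarrow> 'a. in_V w \<longrightarrow> peval p w = peval a w + w 2 * peval b w" by blast
    have "?free (Neg a)" "?free (Neg b)" by (intro allI; simp only: peval.simps *(1,2))+
    moreover have "\<forall>w :: nat \<Rightarrow> 'a. in_V w \<longrightarrow> peval (Neg p) w = peval (Neg a) w + w 2 * peval (Neg b) w"
      using *(3) by simp
    ultimately show ?case by blast
  qed
  then show thesis using that by blast
qed

text \<open>The parameter is \<open>t = (P + Q) / (R + S) = (R - S) / (P - Q)\<close>, the two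
  quotients agreeing by \<open>P^2 - Q^2 = R^2 - S^2\<close>. It fails to exist only if both
  denominators vanish and a numerator does not.\<close>

lemma in_V_chart:
  fixes w :: "nat \<Rightarrow> 'a::field_char_0"
  assumes V: "in_V w" and pad: "\<And>i. i \<ge> 7 \<Longrightarrow> w i = 0"
    and nz: "w 3 \<noteq> w 4 \<or> w 5 + w 6 \<noteq> 0 \<or> (w 3 = 0 \<and> w 5 = 0)"
  obtains t where "w = chart t (w 3 - w 4) (w 5 + w 6) (2 * w 2)"
proof -
  have x: "2 * w 0 = 1 + (w 3)^2 - (w 4)^2" and y: "2 * w 1 = 1 + (w 3)^2 - (w 5)^2"
    and pq: "(w 3 - w 4) * (w 3 + w 4) = (w 5 - w 6) * (w 5 + w 6)"
    using V unfolding in_V_def by algebra+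
  obtain t where t: "t * (w 5 + w 6) = w 3 + w 4" "t * (w 3 - w 4) = w 5 - w 6"
  proof -
    consider "w 5 + w 6 \<noteq> 0" | "w 3 \<noteq> w 4" "w 5 + w 6 = 0" | "w 3 = w 4" "w 5 + w 6 = 0" "w 3 = 0" "w 5 = 0"
      using nz by blast
    then show thesis
    proof cases
      case 1
      show ?thesis by (rule that[of "(w 3 + w 4) / (w 5 + w 6)"]) (use 1 pq in \<open>simp_all add: field_simps\<close>)
    next
      case 2
      have "w 3 + w 4 = 0" using 2 pq by simp
      then show ?thesis by (rule_tac that[of "(w 5 - w 6) / (w 3 - w 4)"]) (use 2 pq in \<open>simp_all add: field_simps\<close>)
    next
      case 3
      \<comment> \<open>Here all of P, Q, R, S vanish and any \<open>t\<close> would do.\<close>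
      show ?thesis by (rule that[of 0]) (use 3 in auto)
    qed
  qed
  have k: "kcoef t * ((w 5 + w 6)^2 - (w 3 - w 4)^2) = (w 3)^2 - (w 5)^2"
  proof -
    have k4: "4 * kcoef t = t^2 - 1" by (simp add: kcoef_def)
    have "4 * (kcoef t * ((w 5 + w 6)^2 - (w 3 - w 4)^2)) =
      (t * (w 5 + w 6))^2 - (t * (w 3 - w 4))^2 - (w 5 + w 6)^2 + (w 3 - w 4)^2"
      using k4 by algebra
    also have "\<dots> = 4 * ((w 3)^2 - (w 5)^2)" unfolding t using pq by algebra
    finally show ?thesis by (metis mult_cancel_left zero_neq_numeral)
  qed
  show thesis
  proof (rule that[of t], rule ext)
    fix i :: nat
    consider "i = 0" | "i = 1" | "i = 2" | "i = 3" | "i = 4" | "i = 5" | "i = 6" | "i \<ge> 7" by linarith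
    then show "w i = chart t (w 3 - w 4) (w 5 + w 6) (2 * w 2) i"
    proof cases
      case 1
      have "2 * w 0 = 1 + (t * (w 3 - w 4)) * (w 5 + w 6)" unfolding x t(2) using pq by algebra
      then show ?thesis by (simp add: 1 chart_def eq_divide_eq mult.commute[of _ 2])
    next
      case 2
      have "2 * w 1 = 1 + kcoef t * ((w 5 + w 6)^2 - (w 3 - w 4)^2)" unfolding y k by simp
      then show ?thesis by (simp add: 2 chart_def eq_divide_eq mult.commute[of _ 2])
    qed (use t pad in \<open>auto simp: chart_def\<close>)
  qed
qed

text \<open>As \<open>h\<close> ignores z, it vanishes on the chart for every z, whether or not the
  point lies on V. A missed point is, up to z, the value at 0 of a polynomial curve that is in the
  chart elsewhere, so \<open>h\<close> vanishes there too.\<close>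

lemma vanishes_off_chart:
  fixes w :: "nat \<Rightarrow> complex"
  assumes zero: "\<And>t u v. peval h (chart t u v (0 :: complex)) = 0" and free: "\<And>w z. peval h (w(2 := z :: complex)) = peval h w"
    and V: "in_V w" and pad: "\<And>i. i \<ge> 7 \<Longrightarrow> w i = 0"
  shows "peval h w = 0"
proof -
  have chart: "peval h (chart t u v z) = 0" for t u v z :: complex
  proof -
    have "chart t u v z = (chart t u v 0)(2 := z / 2)" by (auto simp: chart_def)
    then show ?thesis by (simp add: free zero)
  qed
  show ?thesis
  proof (cases "w 3 \<noteq> w 4 \<or> w 5 + w 6 \<noteq> 0 \<or> (w 3 = 0 \<and> w 5 = 0)")
    case True
    then show ?thesis using in_V_chart[OF V pad] chart by metis
  next
    case False
    define P R where "P = w 3" and "R = w 5"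
    have w: "w 3 = P" "w 4 = P" "w 5 = R" "w 6 = - R"
      using False by (auto simp: P_def R_def add_eq_0_iff)
    txt \<open>The line through \<open>(P, P, R, -R)\<close> in the cone \<open>P\<^sup>2 + S\<^sup>2 = Q\<^sup>2 + R\<^sup>2\<close> that meets the chart
      in \<open>t = 2 / x\<close>, \<open>u = x R\<close>, \<open>v = x P\<close>.\<close>
    define L :: "complex \<Rightarrow> nat \<Rightarrow> complex" where
      "L = (\<lambda>x. (\<lambda>_. 0)(0 := (1/2) + x * (R * P), 1 := (1/2) + (1/2 + (-1/8) * (x * x)) * (P^2 - R^2),
        3 := P + x * (R/2), 4 := P + x * (-R/2), 5 := R + x * (P/2), 6 := -R + x * (P/2)))"
    have "peval h (L 0) = 0"
    proof (rule polyfun_eq_0[where f = "\<lambda>x. peval h (L x)"])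
      have "polyfun (\<lambda>x. L x i)" for i
        unfolding L_def fun_upd_apply
        by (intro polyfun_If polyfun_const polyfun_id polyfun_add polyfun_mult)
      then show "polyfun (\<lambda>x. peval h (L x))" by (rule polyfun_peval)
      show "infinite (- {0 :: complex})" by (simp add: infinite_UNIV_char_0 Compl_eq_Diff_UNIV)
      fix x :: complex assume "x \<in> - {0}"
      then have "L x = chart (2 / x) (x * R) (x * P) 0"
        by (auto simp: L_def chart_def kcoef_def field_simps power2_eq_square)
      then show "peval h (L x) = 0" by (simp add: chart)
    qed
    moreover have "w = (L 0)(2 := w 2)"
    proof
      fix i :: nat
      have "2 * w 0 = 1" "2 * w 1 = 1 + P^2 - R^2"
        using V unfolding in_V_def w by algebra+
      then have w01: "w 0 = 1 / 2" "w 1 = 1 / 2 + 1 / 2 * (P^2 - R^2)" by algebra+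
      consider "i = 0" | "i = 1" | "i = 2" | "i = 3" | "i = 4" | "i = 5" | "i = 6" | "i \<ge> 7" by linarith
      then show "w i = ((L 0)(2 := w 2)) i"
        by cases (simp_all add: L_def w pad w01[unfolded One_nat_def])
    qed
    from arg_cong[OF this, of "peval h"] have "peval h w = peval h (L 0)" using free[of "L 0" "w 2"] by simp
    ultimately show ?thesis by simp
  qed
qed

theorem theorem4p1:
  shows "V_unirational"
proof -
  let ?num = "\<lambda>i. rnum (coordR i)" and ?den = "\<lambda>i. rden (coordR i)"
  have dense: "peval g w = 0"
    if g: "\<And>t. rdefined ?den t \<Longrightarrow> peval g (rmap ?num ?den t) = 0"
      and pad: "\<And>i. i \<ge> 7 \<Longrightarrow> w i = 0" and V: "in_V w" for g and w :: "nat \<Rightarrow> complex"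
  proof -
    \<comment> \<open>Vanishing at complex parameters, for either square root \<open>y\<close> of
      \<open>slice t v\<close>.\<close>
    have image: "peval g (chart t (step t v d) (v + d * step t v d) (y * yratio t v d)) = 0"
      if tv: "t \<in> good_t" "v \<in> good_v t" and y: "y^2 = slice t v" and den: "step_den t v d \<noteq> 0" for t v d y
    proof -
      obtain p where ok: "\<And>i. i < 7 \<Longrightarrow> rok (coordR i) p" and
        p: "(\<lambda>i. reval (coordR i) p) = chart t (step t v d) (v + d * step t v d) (y * yratio t v d)"
        by (rule coordR_attains[of t v y d]) (use tv y den in \<open>auto simp: good_t_def good_v_def\<close>)
      have pad: "coordR i = RConst 0" if "i \<ge> 7" for i using that by (simp add: coordR_def)
      have "rok (coordR i) p" for i using ok[of i] pad[of i] by (cases "i < 7") auto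
      with g pad have "peval g (\<lambda>i. reval (coordR i) p) = 0" by (intro peval_rmap_complex)
      then show ?thesis by (simp add: p)
    qed
    obtain a b where free: "\<And>w z. peval a (w(2 := z :: complex)) = peval a w" "\<And>w z. peval b (w(2 := z :: complex)) = peval b w"
      and ab: "\<And>w :: nat \<Rightarrow> complex. in_V w \<Longrightarrow> peval g w = peval a w + w 2 * peval b w"
      using split_off_z[of g] by metis
    \<comment> \<open>On the image only z times \<open>b\<close> is known to vanish; one more factor
      z turns it into a polynomial free of z.\<close>
    define b' where "b' = Mul zsquare b"
    have both: "peval a (chart t (step t v d) (v + d * step t v d) 0) = 0 \<and>
        peval b' (chart t (step t v d) (v + d * step t v d) 0) = 0"
      if tv: "t \<in> good_t" "v \<in> good_v t" and den: "step_den t v d \<noteq> 0" for t v d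
    proof -
      let ?c = "chart t (step t v d) (v + d * step t v d)"
      define y where "y = csqrt (slice t v)"
      define z where "z = y * yratio t v d / 2"
      have y: "y^2 = slice t v" "(- y)^2 = slice t v" by (simp_all add: y_def)
      have f: "slice t v \<noteq> 0" using tv by (simp add: good_v_def)
      have c: "?c (2 * x) = (?c 0)(2 := x)" for x by (auto simp: chart_def)
      have V: "in_V (?c (2 * z))" "in_V (?c (2 * (- z)))"
        using chart_in_V[OF quartic_step[OF f den y(1)]] chart_in_V[OF quartic_step[OF f den y(2)]]
        by (simp_all add: z_def)
      have "peval g (?c (2 * z)) = 0" "peval g (?c (2 * (- z))) = 0"
        using image[OF tv y(1) den] image[OF tv y(2) den] by (simp_all add: z_def)
      \<comment> \<open>The roots \<open>y\<close> and \<open>- y\<close> give points with opposite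
        z and otherwise equal coordinates, so the even and odd parts of \<open>g\<close>
        separate.\<close>
      then have 0: "peval a (?c 0) + z * peval b (?c 0) = 0" "peval a (?c 0) - z * peval b (?c 0) = 0"
        using ab[OF V(1)] ab[OF V(2)] unfolding c by (simp_all add: free)
      have "z^2 = peval zsquare (?c 0)"
        using V(1) unfolding c in_V_def by (simp add: peval_zsquare) algebra
      moreover have "peval a (?c 0) = 0" "z * peval b (?c 0) = 0" using 0 by algebra+
      ultimately show ?thesis unfolding b'_def peval.simps by (auto simp: power2_eq_square)
    qed
    have chart0: "peval h (chart t u v 0) = 0" if h: "h \<in> {a, b'}" for h and t u v :: complex
    proof (rule vanishes_on_chart[of "\<lambda>t u v. peval h (chart t u v 0)"])
      show "bipolyfun (\<lambda>u v. peval h (chart t u v 0))" for t :: complex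
        by (intro bipolyfun_peval bipolyfun_chart)
      show "polyfun (\<lambda>t. peval h (chart t u v 0))" for u v :: complex
        by (intro polyfun_peval polyfun_chart)
      show "peval h (chart t (step t v d) (v + d * step t v d) 0) = 0"
        if "t \<in> good_t" "v \<in> good_v t" "step_den t v d \<noteq> 0" for t v d
        using both[OF that] h by auto
    qed
    have "peval a w = 0" "peval b' w = 0"
      using vanishes_off_chart[OF chart0 _ V pad, of a] vanishes_off_chart[OF chart0 _ V pad, of b']
      by (simp_all add: free b'_def peval_zsquare)
    \<comment> \<open>From z^2 \<open>b\<close> = 0 it follows that z \<open>b\<close> = 0, even at
      points with z = 0.\<close>
    moreover have "(w 2)^2 = peval zsquare w"
      using V unfolding in_V_def peval_zsquare by algebra
    ultimately show ?thesis using ab[OF V] by (auto simp: b'_def)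
  qed
  have V: "in_V (rmap ?num ?den t)" if "rdefined ?den t" for t
  proof -
    have ok: "rok (coordR i) t" if "i < 7" for i
      using \<open>rdefined ?den t\<close> that by (simp add: rdefined_def reval_frac)
    then show ?thesis using coordR_in_V[OF ok] by (simp add: in_V_def rmap_def reval_frac)
  qed
  have nonzero: "\<exists>t :: nat \<Rightarrow> rat. peval (?den i) t \<noteq> 0" if "i < 7" for i
  proof (rule ccontr)
    assume "\<not> ?thesis"
    then have zero: "peval (?den i) p = 0" for p :: "nat \<Rightarrow> complex"
      by (intro peval_vanish_complex) blast
    obtain t where t: "t \<in> good_t" using infinite_good_t by (metis finite.emptyI equals0I)
    obtain v where v: "v \<in> good_v t" using infinite_good_v[OF t] by (metis finite.emptyI equals0I)
    \<comment> \<open>One complex parameter in the domain suffices; \<open>d = 0\<close> is allowed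
      because \<open>good_v\<close> requires \<open>step_den t v 0 \<noteq> 0\<close>.\<close>
    obtain p where "\<And>i. i < 7 \<Longrightarrow> rok (coordR i) p"
        "(\<lambda>i. reval (coordR i) p) = chart t (step t v 0) (v + 0 * step t v 0) (csqrt (slice t v) * yratio t v 0)"
      by (rule coordR_attains[of t v "csqrt (slice t v)" 0])
        (use t v in \<open>auto simp: good_t_def good_v_def\<close>)
    then show False using zero[of p] that reval_frac by blast
  qed
  have "dominant_rational_map_to_V ?num ?den"
    unfolding dominant_rational_map_to_V_def using nonzero V dense by blast
  then show ?thesis unfolding V_unirational_def by blast
qed

end
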